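(* Let $p$ be an odd prime, $z\in\mathbb{F}_p^*$, and let $m=\alpha(z,p)$. Then every irreducible factor of $\overline\gamma_z(X)$ in $\mathbb{F}_p[X]$ has degree $m$. In particular $\gamma_z(X)$ and $\tau_z(X)$ have the same splitting field over $\mathbb{F}_p$. Moreover: (1) every root $t$ of $\overline\gamma_z(X)$ lies in $\widehat{\mathcal{Q}^z}$, and distinct roots $t\neq t'$ of $\overline\gamma_z(X)$ lie in distinct planes, i.e. $\mathrm{span}_{\mathbb{F}_p}\{t,1\}\neq\mathrm{span}_{\mathbb{F}_p}\{t',1\}$; (2) if $z^2+4z$ is a non-square in $\mathbb{F}_p$, then $\gamma_z(X)$ has no linear factors over $\mathbb{F}_p$; (3) if $z=-4$, then $\gamma_z(X)$ has the unique linear factor $X-1$; (4) if $z^2+4z$ is a nonzero square in $\mathbb{F}_p$, then $\gamma_z(X)$ has exactly two linear factors over $\mathbb{F}_p$, namely $X-r_+$ and $X-r_-$, where $r_\pm=\frac{-(z+2)\pm\sqrt{z^2+4z}}{2}$.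
   Context: $\mathbb{F}$ is an algebraic closure of $\mathbb{F}_p$. For $x,y\in\mathbb{F}$, $[i,j]:=x^{p^i}y^{p^j}-x^{p^j}y^{p^i}$ and, for $x,y$ linearly independent over $\mathbb{F}_p$, $\nu(x,y):=-\frac{[0,2][1,3]}{[0,1][2,3]}$. For $m\ge1$, $\mathcal{Z}(m)=\{\nu(x,y):x,y\in\mathbb{F}_{p^m}\text{ lin. indep. over }\mathbb{F}_p\}$, $f_{m,p}(X)=\prod_{w\in\mathcal{Z}(m)\setminus\{0\}}(X-w)$. The order of appearance $\alpha(z,p)$ is the least $m\ge1$ with $f_{m,p}(z)=0$. $\widehat{\mathcal{Q}^z}:=\{x\in\mathbb{F}\setminus\mathbb{F}_p:\nu(x,1)=z\}$. $\gamma_z(X):=X^{p+1}+(1+z)X^p+X+1$, $\tau_z(X):=\gamma_z((X^p-X)^{p-1})$, and $\overline\gamma_z(X):=1$ if $z=0$; $\gamma_z(X)/(X-1)$ if $z=-4$; $\gamma_z(X)/(X^2+(z+2)X+1)$ if $z\neq0,-4$ and $z^2+4z$ is a square in $\mathbb{F}_p$; $\gamma_z(X)$ if $z^2+4z$ is a non-square. *)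

theory Defs
  imports
    "Berlekamp_Zassenhaus.Finite_Field"
    "HOL-Algebra.Algebraic_Closure_Type"
    "HOL-Algebra.Generated_Fields"
begin

text \<open>
  The prime field is \<open>'p mod_ring\<close> with \<open>p = CARD('p)\<close>, its algebraic closure is
  \<open>'p mod_ring alg_closure\<close>, and \<^const>\<open>to_ac\<close> is the embedding, so that the prime field
  as a subset of its closure is \<^term>\<open>range to_ac\<close>.
\<close>

type_synonym 'p Fp = "'p mod_ring"
type_synonym 'p Fpbar = "'p mod_ring alg_closure"

global_interpretation Fp: Vector_Spaces.vector_space
    "\<lambda>(a :: 'p :: prime_card Fp) (x :: 'p Fpbar). to_ac a * x"
  by unfold_locales (simp_all add: algebra_simps)

text \<open>The condition \<open>x \<noteq> y\<close> is needed because \<open>{x, x}\<close> collapses to a singleton.\<close>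

definition lin_indep :: "'p :: prime_card Fpbar \<Rightarrow> 'p Fpbar \<Rightarrow> bool" where
  "lin_indep x y \<longleftrightarrow> x \<noteq> y \<and> Fp.independent {x, y}"

lemma lin_indep_iff:
  "lin_indep (x :: 'p :: prime_card Fpbar) y \<longleftrightarrow>
     (\<forall>a b. to_ac a * x + to_ac b * y = 0 \<longrightarrow> a = 0 \<and> b = 0)"
proof
  assume "lin_indep x y"
  hence ne: "x \<noteq> y" and i: "Fp.independent {x, y}" by (auto simp: lin_indep_def)
  show "\<forall>a b. to_ac a * x + to_ac b * y = 0 \<longrightarrow> a = 0 \<and> b = 0"
  proof safe
    fix a b :: "'p Fp" assume eq: "to_ac a * x + to_ac b * y = 0"
    define u where "u = (\<lambda>v. if v = x then a else b)"
    have s: "(\<Sum>v\<in>{x, y}. to_ac (u v) * v) = 0" using ne eq by (simp add: u_def)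
    have "u v = 0" if "v \<in> {x, y}" for v
      using Fp.independentD[OF i _ _ s that] by simp
    from this[of x] this[of y] show "a = 0" "b = 0" using ne by (simp_all add: u_def)
  qed
next
  assume *: "\<forall>a b. to_ac a * x + to_ac b * y = 0 \<longrightarrow> a = 0 \<and> b = 0"
  have ne: "x \<noteq> y" using *[rule_format, of 1 "-1"] by auto
  moreover have "Fp.independent {x, y}"
    unfolding Fp.dependent_finite[OF finite.insertI[OF finite.insertI[OF finite.emptyI]]]
    using ne * by auto
  ultimately show "lin_indep x y" by (simp add: lin_indep_def)
qed

definition bracket :: "'p :: prime_card Fpbar \<Rightarrow> 'p Fpbar \<Rightarrow> nat \<Rightarrow> nat \<Rightarrow> 'p Fpbar" where
  "bracket x y i j =
     x ^ (CARD('p) ^ i) * y ^ (CARD('p) ^ j) - x ^ (CARD('p) ^ j) * y ^ (CARD('p) ^ i)"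

text \<open>Only meaningful for linearly independent arguments; otherwise the denominator is 0.\<close>

definition nu :: "'p :: prime_card Fpbar \<Rightarrow> 'p Fpbar \<Rightarrow> 'p Fpbar" where
  "nu x y = - (bracket x y 0 2 * bracket x y 1 3) / (bracket x y 0 1 * bracket x y 2 3)"

text \<open>
  For \<open>m \<ge> 1\<close> this is the unique subfield with \<open>p ^ m\<close> elements, see
  \<open>subfield_of_degree_unique\<close>. The value at \<open>m = 0\<close> is a junk value.
\<close>

definition subfield_of_degree :: "nat \<Rightarrow> 'p :: prime_card Fpbar set" where
  "subfield_of_degree m = {x. x ^ (CARD('p) ^ m) = x}"

lemma CHAR_Fpbar: "CHAR('p :: prime_card Fpbar) = CARD('p)"
  by simp

lemma of_nat_CARD_Fpbar: "of_nat CARD('p :: prime_card) = (0 :: 'p Fpbar)"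
  by (metis CHAR_Fpbar of_nat_CHAR)

lemma Fpbar_add_power: "(x + y :: 'p :: prime_card Fpbar) ^ (CARD('p) ^ m) =
    x ^ (CARD('p) ^ m) + y ^ (CARD('p) ^ m)"
  by (rule freshmans_dream') (simp_all add: prime_card)

lemma Fpbar_uminus_power: "(- x :: 'p :: prime_card Fpbar) ^ (CARD('p) ^ m) = - (x ^ (CARD('p) ^ m))"
proof -
  have pos: "(0::nat) < CARD('p) ^ m" by simp
  have "(x + - x) ^ (CARD('p) ^ m) = x ^ (CARD('p) ^ m) + (- x) ^ (CARD('p) ^ m)"
    by (rule Fpbar_add_power)
  thus ?thesis using pos by (simp add: power_0_left eq_neg_iff_add_eq_0 add.commute)
qed

lemma ring_of_type_inv:
  fixes x :: "'a :: Fields.field"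
  assumes "x \<noteq> 0"
  shows "inv\<^bsub>ring_of_type_algebra\<^esub> x = inverse x"
proof -
  interpret R: Ring.field "ring_of_type_algebra :: 'a ring" by (rule field_from_type_algebra)
  show ?thesis
    by (rule R.comm_inv_char) (use assms in \<open>auto simp: ring_of_type_algebra_def\<close>)
qed

lemma subfield_subfield_of_degree:
  "subfield (subfield_of_degree m :: 'p :: prime_card Fpbar set) ring_of_type_algebra"
proof -
  interpret R: Ring.field "ring_of_type_algebra :: 'p Fpbar ring" by (rule field_from_type_algebra)
  have pos: "(0::nat) < CARD('p) ^ m" by simp
  have neg: "\<ominus>\<^bsub>ring_of_type_algebra\<^esub> x = - x" for x :: "'p Fpbar"
    by (rule sym, rule R.sum_zero_eq_neg) (auto simp: ring_of_type_algebra_def)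
  show ?thesis
  proof (rule R.subfieldI')
    show "subring (subfield_of_degree m) (ring_of_type_algebra :: 'p Fpbar ring)"
      by (rule R.subringI)
         (auto simp: neg, auto simp: ring_of_type_algebra_def subfield_of_degree_def
           Fpbar_add_power Fpbar_uminus_power power_mult_distrib)
  next
    fix k :: "'p Fpbar"
    assume k: "k \<in> subfield_of_degree m - {\<zero>\<^bsub>ring_of_type_algebra\<^esub>}"
    hence "k \<noteq> 0" by (auto simp: ring_of_type_algebra_def)
    thus "inv\<^bsub>ring_of_type_algebra\<^esub> k \<in> subfield_of_degree m"
      using k by (simp add: ring_of_type_inv) (simp add: subfield_of_degree_def power_inverse)
  qed
qed

lemma card_subfield_of_degree:
  assumes "m \<ge> 1"
  shows "card (subfield_of_degree m :: 'p :: prime_card Fpbar set) = CARD('p) ^ m"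
proof -
  define q where "q = CARD('p) ^ m"
  have "CARD('p) > 1" using prime_card prime_gt_1_nat by blast
  hence q: "q > 1" unfolding q_def by (rule one_less_power) (use assms in simp)
  define Q :: "'p Fpbar poly" where "Q = monom 1 q - monom 1 1"
  have deg: "Polynomial.degree Q = q"
    unfolding Q_def using q
    by (subst diff_conv_add_uminus, subst degree_add_eq_left) (auto simp: degree_monom_eq)
  have poly_Q: "poly Q x = x ^ q - x" for x by (simp add: Q_def poly_monom)
  have q0: "(of_nat q :: 'p Fpbar) = 0"
    using assms by (simp add: q_def of_nat_CARD_Fpbar power_0_left)
  have pd: "pderiv Q = -1"
    by (simp add: Q_def pderiv_diff pderiv_monom q0 monom_0 one_pCons)
  have "Q \<noteq> 0" using deg q by auto
  then obtain A where A: "size A = Polynomial.degree Q"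
      "Q = smult (Polynomial.lead_coeff Q) (\<Prod>x\<in>#A. [:-x, 1:])"
    using alg_closed_imp_factorization by blast
  have roots: "poly Q x = 0 \<longleftrightarrow> x \<in># A" for x
    by (subst A(2)) (use \<open>Q \<noteq> 0\<close> in \<open>auto simp: poly_prod_mset prod_mset_zero_iff\<close>)
  have "count A x = 1" if x: "x \<in># A" for x
  proof (rule ccontr)
    assume "count A x \<noteq> 1"
    hence "count A x \<ge> 2" using x by (metis One_nat_def Suc_1 Suc_leI count_greater_zero_iff le_neq_implies_less)
    hence "{#x, x#} \<subseteq># A" by (auto simp: subseteq_mset_def)
    then obtain B where "A = {#x, x#} + B" by (metis subset_mset.le_iff_add)
    hence "(\<Prod>x\<in>#A. [:-x, 1:]) = ([:-x,1:] * [:-x,1:]) * (\<Prod>x\<in>#B. [:-x, 1:])"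
      by (simp only: image_mset_union prod_mset_Un image_mset_add_mset
        image_mset_empty prod_mset.add_mset prod_mset_empty mult_1_right)
    hence "[:-x,1:] * [:-x,1:] dvd Q" by (metis A(2) dvd_smult dvd_triv_left)
    then obtain r where "Q = ([:-x,1:] * [:-x,1:]) * r" by (elim dvdE)
    hence "poly (pderiv Q) x = 0" by (simp only: pderiv_mult poly_add poly_mult) simp
    thus False using pd by simp
  qed
  hence "card (set_mset A) = size A" by (simp add: size_multiset_overloaded_eq)
  moreover have "subfield_of_degree m = set_mset A"
    by (auto simp: subfield_of_degree_def simp flip: roots) (auto simp: poly_Q q_def)
  ultimately show ?thesis using A(1) deg by (simp add: q_def)
qed

lemma subfield_of_degree_unique:
  fixes K :: "'p :: prime_card Fpbar set"
  assumes "m \<ge> 1"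
  shows "subfield K ring_of_type_algebra \<and> card K = CARD('p) ^ m \<longleftrightarrow> K = subfield_of_degree m"
proof safe
  interpret R: Ring.field "ring_of_type_algebra :: 'p Fpbar ring" by (rule field_from_type_algebra)
  assume K: "subfield K ring_of_type_algebra" and card: "card K = CARD('p) ^ m"
  have fin: "finite K" by (rule card_ge_0_finite) (simp add: card)
  have zero: "0 \<in> K"
    using subringE(2)[OF subfieldE(1)[OF K]] by (simp add: ring_of_type_algebra_def)
  have mult: "x * y \<in> K" if "x \<in> K" "y \<in> K" for x y
    using subringE(6)[OF subfieldE(1)[OF K]] that by (simp add: ring_of_type_algebra_def)
  have "x ^ (CARD('p) ^ m) = x" if x: "x \<in> K" for x
  proof (cases "x = 0")
    case False
    have inj: "inj_on ((*) x) (K - {0})" using False by (auto intro: inj_onI)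
    have "(*) x ` (K - {0}) \<subseteq> K - {0}" using mult x False by auto
    hence im: "(*) x ` (K - {0}) = K - {0}"
      using inj fin by (simp add: endo_inj_surj)
    have "(\<Prod>y\<in>K - {0}. y) = (\<Prod>y\<in>K - {0}. x * y)"
      using prod.reindex[OF inj, of "\<lambda>y. y"] by (simp add: im)
    also have "\<dots> = x ^ card (K - {0}) * (\<Prod>y\<in>K - {0}. y)"
      by (simp add: prod.distrib)
    finally have "x ^ card (K - {0}) = 1" using fin by simp
    hence "x ^ Suc (card (K - {0})) = x" by simp
    moreover have "Suc (card (K - {0})) = card K"
      using fin zero by (rule card_Suc_Diff1)
    ultimately show ?thesis by (simp add: card)
  qed (simp add: power_0_left)
  hence "K \<subseteq> subfield_of_degree m" by (auto simp: subfield_of_degree_def)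
  moreover have "finite (subfield_of_degree m :: 'p Fpbar set)"
    by (rule card_ge_0_finite) (simp add: card_subfield_of_degree[OF assms])
  ultimately have "K = subfield_of_degree m"
    by (simp add: card_subset_eq card card_subfield_of_degree[OF assms])
  thus "x \<in> K \<Longrightarrow> x \<in> subfield_of_degree m" "x \<in> subfield_of_degree m \<Longrightarrow> x \<in> K" for x by auto
qed (simp_all add: subfield_subfield_of_degree card_subfield_of_degree[OF assms])

definition Z_set :: "nat \<Rightarrow> 'p :: prime_card Fpbar set" where
  "Z_set m = {nu x y | x y.
     x \<in> subfield_of_degree m \<and> y \<in> subfield_of_degree m \<and> lin_indep x y}"

definition f_poly :: "nat \<Rightarrow> 'p :: prime_card Fpbar poly" where
  "f_poly m = (\<Prod>w \<in> Z_set m - {0}. [:- w, 1:])"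

definition order_of_appearance :: "'p :: prime_card Fp \<Rightarrow> nat" where
  "order_of_appearance z = (LEAST m. m \<ge> 1 \<and> poly (f_poly m) (to_ac z) = 0)"

definition Q_hat :: "'p :: prime_card Fp \<Rightarrow> 'p Fpbar set" where
  "Q_hat z = {x. x \<notin> range to_ac \<and> nu x 1 = to_ac z}"

definition gamma :: "'p :: prime_card Fp \<Rightarrow> 'p Fp poly" where
  "gamma z = [:0, 1:] ^ (CARD('p) + 1) + smult (1 + z) ([:0, 1:] ^ CARD('p)) + [:0, 1:] + 1"

definition tau :: "'p :: prime_card Fp \<Rightarrow> 'p Fp poly" where
  "tau z = pcompose (gamma z) (([:0, 1:] ^ CARD('p) - [:0, 1:]) ^ (CARD('p) - 1))"

text \<open>The divisions below are exact for odd \<open>p\<close>, see \<open>gamma_bar_exact\<close>.\<close>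

definition gamma_bar :: "'p :: prime_card Fp \<Rightarrow> 'p Fp poly" where
  "gamma_bar z =
     (if z = 0 then 1
      else if z = -4 then gamma z div [:-1, 1:]
      else if is_square (z ^ 2 + 4 * z) then gamma z div [:1, z + 2, 1:]
      else gamma z)"

lemma Fp_power_CARD: "(r :: 'p :: prime_card Fp) ^ CARD('p) = r"
proof -
  show ?thesis
  proof (cases "r = 0")
    case False
    have inj: "inj_on ((*) r) (UNIV - {0})" using False by (auto intro: inj_onI)
    have "(*) r ` (UNIV - {0}) \<subseteq> UNIV - {0}" using False by auto
    hence im: "(*) r ` (UNIV - {0}) = UNIV - {0}"
      using inj by (simp add: endo_inj_surj)
    have "(\<Prod>y\<in>UNIV - {0}. y) = (\<Prod>y\<in>UNIV - {0}. r * y)"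
      using prod.reindex[OF inj, of "\<lambda>y. y"] by (simp add: im)
    also have "\<dots> = r ^ card (UNIV - {0 :: 'p Fp}) * (\<Prod>y\<in>UNIV - {0}. y)"
      by (simp add: prod.distrib)
    finally have "r ^ card (UNIV - {0 :: 'p Fp}) = 1" by simp
    hence "r ^ Suc (card (UNIV - {0 :: 'p Fp})) = r" by (simp only: power_Suc mult_1_right)
    moreover have "Suc (card (UNIV - {0 :: 'p Fp})) = CARD('p)"
      using card_Suc_Diff1[of "UNIV :: 'p Fp set" 0] by simp
    ultimately show ?thesis by simp
  qed (simp add: power_0_left)
qed

lemma poly_gamma: "poly (gamma z) r = r ^ 2 + (z + 2) * r + 1"
  by (simp add: gamma_def Fp_power_CARD power2_eq_square algebra_simps)

lemma gamma_bar_exact: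
  fixes z :: "'p :: prime_card Fp"
  assumes "odd CARD('p)"
  shows "z = -4 \<Longrightarrow> [:-1, 1:] dvd gamma z"
    and "z \<noteq> 0 \<Longrightarrow> z \<noteq> -4 \<Longrightarrow> is_square (z ^ 2 + 4 * z) \<Longrightarrow> [:1, z + 2, 1:] dvd gamma z"
proof -
  assume "z = -4"
  thus "[:-1, 1:] dvd gamma z"
    by (simp add: dvd_iff_poly_eq_0 poly_gamma)
next
  assume z: "z \<noteq> 0" "z \<noteq> -4" and "is_square (z ^ 2 + 4 * z)"
  then obtain s where s: "s ^ 2 = z ^ 2 + 4 * z" by (auto simp: is_nth_power_def)
  have two: "(2 :: 'p Fp) \<noteq> 0"
  proof
    assume "(2 :: 'p Fp) = 0"
    hence "of_nat 2 = (0 :: 'p Fp)" by simp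
    hence "CARD('p) dvd 2" by (simp only: of_nat_0_mod_ring_dvd)
    moreover have "CARD('p) > 1" using prime_card prime_gt_1_nat by blast
    ultimately have "CARD('p) = 2" by (auto dest!: dvd_imp_le)
    thus False using assms by simp
  qed
  have "z * (z + 4) \<noteq> 0" using z by (auto simp: eq_neg_iff_add_eq_0)
  hence "s \<noteq> 0" using s by (auto simp: power2_eq_square algebra_simps)
  define a b where "a = (- (z + 2) + s) / 2" and "b = (- (z + 2) - s) / 2"
  have ab: "a + b = - (z + 2)"
    by (simp add: a_def b_def two flip: add_divide_distrib)
  have "a - b = s" using two by (simp add: a_def b_def flip: diff_divide_distrib)
  hence "a \<noteq> b" using \<open>s \<noteq> 0\<close> by auto
  have four: "(4 :: 'p Fp) \<noteq> 0" 
  proof -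
    have "(2 :: 'p Fp) * 2 \<noteq> 0" using two by (simp only: mult_eq_0_iff) simp
    thus ?thesis by simp
  qed
  have ab2: "2 * a = - (z + 2) + s" "2 * b = - (z + 2) - s"
    using two by (simp_all add: a_def b_def)
  have "4 * (a * b) = (2 * a) * (2 * b)" by simp
  also have "\<dots> = (z + 2) ^ 2 - s ^ 2"
    by (simp only: ab2) (simp add: power2_eq_square algebra_simps)
  also have "\<dots> = 4" by (simp add: s) (simp add: power2_eq_square algebra_simps)
  finally have "4 * (a * b) = 4 * 1" by simp
  hence prod: "a * b = 1" using four by (subst (asm) mult_cancel_left) simp
  have quad: "[:-a, 1:] * [:-b, 1:] = [:1, z + 2, 1:]"
  proof -
    have "[:-a, 1:] * [:-b, 1:] = [:a * b, - (a + b), 1:]" by simp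
    thus ?thesis by (simp only: ab prod minus_minus)
  qed
  have eq: "poly (gamma z) r = poly ([:-a, 1:] * [:-b, 1:]) r" for r
    unfolding quad poly_gamma by (simp add: power2_eq_square algebra_simps)
  have root: "poly (gamma z) a = 0" "poly (gamma z) b = 0"
    unfolding eq poly_mult by simp_all
  then obtain g where g: "gamma z = [:-a, 1:] * g" by (auto simp: poly_eq_0_iff_dvd elim: dvdE)
  have "poly g b = 0" using root(2) \<open>a \<noteq> b\<close> by (simp add: g)
  then obtain h where "g = [:-b, 1:] * h" by (auto simp: poly_eq_0_iff_dvd elim: dvdE)
  hence "gamma z = [:1, z + 2, 1:] * h" by (simp only: g mult.assoc flip: quad)
  thus "[:1, z + 2, 1:] dvd gamma z" by (rule dvdI)
qed

definition ac_roots :: "'p :: prime_card Fp poly \<Rightarrow> 'p Fpbar set" where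
  "ac_roots f = {t. poly (map_poly to_ac f) t = 0}"

text \<open>The splitting field inside the fixed algebraic closure.\<close>

definition splitting_field :: "'p :: prime_card Fp poly \<Rightarrow> 'p Fpbar set" where
  "splitting_field f = generate_field ring_of_type_algebra (range to_ac \<union> ac_roots f)"

text \<open>Linear factors are represented by their monic associates.\<close>

definition linear_factors :: "'p :: prime_card Fp poly \<Rightarrow> 'p Fp poly set" where
  "linear_factors f = {q. q dvd f \<and> Polynomial.degree q = 1 \<and> Polynomial.lead_coeff q = 1}"

end

theory Submission
  imports Defs "Berlekamp_Zassenhaus.Distinct_Degree_Factorization"
begin

text \<open>
  The value \<open>\<nu>(x, 1)\<close> is, up to sign, a cross ratio of the first four Frobenius conjugates of \<open>x\<close>, so
  \<open>PGL\<^sub>2(F\<^sub>p)\<close> acts on \<open>Q_hat z\<close>. Since \<open>z \<noteq> 0\<close>, no element of \<open>Q_hat z\<close> lies in the field with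
  \<open>p ^ 2\<close> elements, so this action is free. As \<open>Q_hat z\<close> consists of roots of \<open>tau z\<close>, whose degree
  \<open>(p + 1) p (p - 1)\<close> is the order of \<open>PGL\<^sub>2(F\<^sub>p)\<close>, it is a single orbit and the full root set of
  \<open>tau z\<close>. Hence all its elements generate the same field, and the order of appearance of \<open>z\<close> is the
  degree of that field. Finally, a root of \<open>gamma z\<close> is an element on which Frobenius acts as a certain
  Moebius map of trace \<open>z\<close> and determinant \<open>- z\<close>, which determines the cross ratio: the roots of
  \<open>gamma z\<close> outside \<open>F\<^sub>p\<close>, i.e. the roots of \<open>gamma_bar z\<close>, lie in \<open>Q_hat z\<close>.
\<close>

section \<open>Frobenius powers and the prime field\<close>

definition frob :: "nat \<Rightarrow> 'p :: prime_card Fpbar \<Rightarrow> 'p Fpbar" where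
  "frob i x = x ^ (CARD('p) ^ i)"

lemma frob_0 [simp]: "frob 0 x = x"
  by (simp add: frob_def)

lemma frob_frob [simp]: "frob i (frob j x) = frob (i + j) x"
  by (simp add: frob_def power_add mult.commute flip: power_mult)

lemma frob_add [simp]: "frob i (x + y) = frob i x + frob i y"
  by (simp add: frob_def Fpbar_add_power)

lemma frob_uminus [simp]: "frob i (- x) = - frob i x"
  by (simp add: frob_def Fpbar_uminus_power)

lemma frob_diff [simp]: "frob i (x - y) = frob i x - frob i y"
  using frob_add[of i x "- y"] by simp

lemma frob_mult [simp]: "frob i (x * y) = frob i x * frob i y"
  by (simp add: frob_def power_mult_distrib)

lemma frob_divide [simp]: "frob i (x / y) = frob i x / frob i y"
  by (simp add: frob_def power_divide)

lemma frob_zero_iff [simp]: "frob i x = 0 \<longleftrightarrow> x = 0"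
  by (simp add: frob_def)

lemma frob_one [simp]: "frob i 1 = 1"
  by (simp add: frob_def)

lemma subfield_of_degree_iff: "x \<in> subfield_of_degree m \<longleftrightarrow> frob m x = x"
  by (simp add: subfield_of_degree_def frob_def)

text \<open>Fermat's little theorem gives one inclusion, and both sides have \<open>p\<close>
  elements. This makes membership in the prime field a Frobenius condition.\<close>

lemma subfield_of_degree_1: "(subfield_of_degree 1 :: 'p :: prime_card Fpbar set) = range to_ac"
proof (rule sym, rule card_subset_eq)
  show "finite (subfield_of_degree 1 :: 'p Fpbar set)"
    by (rule card_ge_0_finite) (simp add: card_subfield_of_degree)
  show "range to_ac \<subseteq> (subfield_of_degree 1 :: 'p Fpbar set)"
    by (auto simp: subfield_of_degree_def Fp_power_CARD simp flip: to_ac_power)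
  show "card (range (to_ac :: 'p Fp \<Rightarrow> _)) = card (subfield_of_degree 1 :: 'p Fpbar set)"
    using card_subfield_of_degree[where 'p = 'p, of 1] by (simp add: card_image inj_to_ac)
qed

lemma frob_1_eq_iff: "frob 1 x = x \<longleftrightarrow> x \<in> range to_ac"
  by (simp only: subfield_of_degree_1 flip: subfield_of_degree_iff)

lemma frob_to_ac [simp]: "frob i (to_ac a) = to_ac a"
proof (induction i)
  case (Suc i)
  have "frob (Suc i) (to_ac a) = frob i (frob 1 (to_ac a))" by (subst frob_frob) simp
  moreover have "frob 1 (to_ac a) = to_ac a" by (subst frob_1_eq_iff) simp
  ultimately show ?case using Suc by metis
qed simp

text \<open>Subtracting the relation from its Frobenius conjugate and cancelling
  \<open>frob 1 t - t\<close> leaves a linear relation in \<open>frob 1 t + t\<close>. Doing this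
  once more leaves \<open>to_ac a * (frob 2 t - t) = 0\<close>.\<close>

lemma quadratic_relation_trivial:
  fixes t :: "'p :: prime_card Fpbar"
  assumes t: "frob 2 t \<noteq> t"
    and rel: "to_ac a * t ^ 2 + to_ac b * t + to_ac c = 0"
  shows "a = 0" "b = 0" "c = 0"
proof -
  have t1: "frob 1 t \<noteq> t"
  proof
    assume "frob 1 t = t"
    hence "frob 1 (frob 1 t) = t" by simp
    thus False using t by (simp add: numeral_2_eq_2)
  qed
  have "frob 1 (to_ac a * t ^ 2 + to_ac b * t + to_ac c) = 0" by (simp only: rel frob_zero_iff)
  hence "to_ac a * frob 1 t ^ 2 + to_ac b * frob 1 t + to_ac c = 0" by (simp add: power2_eq_square)
  hence "(frob 1 t - t) * (to_ac a * (frob 1 t + t) + to_ac b) = 0"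
  proof -
    have "(u - t) * (A * (u + t) + B) = (A * u ^ 2 + B * u + C) - (A * t ^ 2 + B * t + C)"
      for u A B C :: "'p Fpbar"
      by (simp add: algebra_simps power2_eq_square)
    from this[of "frob 1 t" "to_ac a" "to_ac b" "to_ac c"] show ?thesis
      using rel \<open>to_ac a * frob 1 t ^ 2 + to_ac b * frob 1 t + to_ac c = 0\<close> by simp
  qed
  hence sum: "to_ac a * (frob 1 t + t) + to_ac b = 0" using t1 by simp
  hence "frob 1 (to_ac a * (frob 1 t + t) + to_ac b) = 0" by (simp only: frob_zero_iff)
  hence "to_ac a * (frob 2 t + frob 1 t) + to_ac b = 0" by (simp add: numeral_2_eq_2)
  hence "to_ac a * (frob 2 t + frob 1 t) + to_ac b - (to_ac a * (frob 1 t + t) + to_ac b) = 0"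
    using sum by simp
  hence "to_ac a * (frob 2 t - t) = 0" by (simp only: algebra_simps) simp
  thus a: "a = 0" using t by simp
  thus b: "b = 0" using sum by simp
  show "c = 0" using rel a b by simp
qed

section \<open>The action of Moebius maps over the prime field on \<open>Q_hat z\<close>\<close>

lemma nu_one:
  "nu x 1 = - ((x - frob 2 x) * (frob 1 x - frob 3 x)) / ((x - frob 1 x) * (frob 2 x - frob 3 x))"
  by (simp add: nu_def bracket_def frob_def)

lemma nu_one_affine:
  assumes "a \<noteq> 0"
  shows "nu (to_ac a * x + to_ac b) 1 = nu x 1"
proof -
  have "frob i (to_ac a * x + to_ac b) - frob j (to_ac a * x + to_ac b)
          = to_ac a * (frob i x - frob j x)" for i j
    by (simp add: algebra_simps)
  \<comment> \<open>The instance \<open>i = 0\<close> is listed separately because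
    \<open>frob_0\<close> rewrites its left-hand side.\<close>
  from this[of 0] this show ?thesis using assms
    by (simp add: nu_one del: frob_add frob_mult)
qed

text \<open>Inversion divides each difference of conjugates by minus the product of the two. Each of
  the four conjugates occurs once in the numerator and once in the denominator of
  \<open>nu_one\<close>, so these factors cancel.\<close>

lemma nu_one_inverse:
  assumes "x \<noteq> 0"
  shows "nu (1 / x) 1 = nu x 1"
proof -
  have "frob i (1 / x) - frob j (1 / x) = - (frob i x - frob j x) / (frob i x * frob j x)" for i j
    using assms by (simp add: field_simps)
  note diff = this[of 0, simplified frob_0] this
  \<comment> \<open>The simplifier writes \<open>frob 1\<close> as \<open>frob (Suc 0)\<close>, so
    the sign changes are stated in that form.\<close>
  have "(frob 2 x - x) * (frob 3 x - frob (Suc 0) x) = (x - frob 2 x) * (frob (Suc 0) x - frob 3 x)"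
    and "(frob (Suc 0) x - x) * (frob 3 x - frob 2 x) = (x - frob (Suc 0) x) * (frob 2 x - frob 3 x)"
    by (simp_all add: algebra_simps)
  thus ?thesis using assms
    by (simp add: nu_one diff del: frob_divide)
qed

text \<open>Otherwise the factor \<open>x - frob 2 x\<close> in the numerator of
  \<open>nu_one\<close> would vanish and force \<open>z = 0\<close>.\<close>

lemma Q_hat_frob_2:
  assumes "x \<in> Q_hat z" "z \<noteq> 0"
  shows "frob 2 x \<noteq> x"
  using assms by (auto simp: Q_hat_def nu_one)

lemma Q_hat_affine_iff:
  assumes "a \<noteq> 0"
  shows "to_ac a * x + to_ac b \<in> Q_hat z \<longleftrightarrow> x \<in> Q_hat z"
proof -
  have "frob 1 (to_ac a * x + to_ac b) = to_ac a * x + to_ac b \<longleftrightarrow> frob 1 x = x"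
    using assms by simp
  thus ?thesis using assms by (simp add: Q_hat_def nu_one_affine flip: frob_1_eq_iff)
qed

lemma Q_hat_inverse:
  assumes "x \<in> Q_hat z"
  shows "1 / x \<in> Q_hat z"
proof -
  have "x \<noteq> 0" using assms by (auto simp: Q_hat_def simp flip: frob_1_eq_iff)
  thus ?thesis using assms by (simp add: Q_hat_def nu_one_inverse flip: frob_1_eq_iff)
qed

lemma Q_hat_mobius:
  assumes "x \<in> Q_hat z" "a \<noteq> 0"
  shows "to_ac a / (x - to_ac c) + to_ac b \<in> Q_hat z"
proof -
  have "x - to_ac c \<in> Q_hat z"
    using Q_hat_affine_iff[of 1 x "- c" z] assms by simp
  from Q_hat_inverse[OF this] show ?thesis
    using Q_hat_affine_iff[OF assms(2), of "1 / (x - to_ac c)" b z] by simp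
qed

text \<open>
  The index set \<open>{a. a \<noteq> 0} \<times> UNIV\<close> enumerates the elements of \<open>PGL\<^sub>2(F\<^sub>p)\<close> by normal forms; the
  third component is the pole, \<open>None\<close> standing for infinity.
\<close>

fun mobius :: "'p :: prime_card Fpbar \<Rightarrow> 'p Fp \<times> 'p Fp \<times> 'p Fp option \<Rightarrow> 'p Fpbar" where
  "mobius t (a, b, None) = to_ac a * t + to_ac b"
| "mobius t (a, b, Some c) = to_ac a / (t - to_ac c) + to_ac b"

text \<open>Equating two normal forms and clearing denominators gives a relation of degree at most 2
  for \<open>t\<close> over the prime field, so all its coefficients vanish.\<close>

lemma inj_on_mobius:
  fixes t :: "'p :: prime_card Fpbar"
  assumes t: "frob 2 t \<noteq> t"
  shows "inj_on (mobius t) ({a. a \<noteq> 0} \<times> UNIV)"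
proof -
  note triv = quadratic_relation_trivial[OF t]
  have ne: "t - to_ac c \<noteq> 0" for c using t by auto
  have mixed: False if "to_ac a * t + to_ac b = to_ac a' / (t - to_ac c) + to_ac b'" "a \<noteq> 0"
    for a b a' b' c
  proof -
    have "(to_ac a * t + to_ac b - to_ac b') * (t - to_ac c) = to_ac a'"
      using that ne[of c] by (simp add: field_simps)
    hence "to_ac a * t ^ 2 + to_ac (b - b' - a * c) * t + to_ac (- (b - b') * c - a') = 0"
      by (simp add: algebra_simps power2_eq_square)
    \<comment> \<open>The leading coefficient is \<open>a\<close> itself, so an affine map never
      agrees at \<open>t\<close> with a map having a finite pole.\<close>
    from triv(1)[OF this] show False using \<open>a \<noteq> 0\<close> by simp
  qed
  have clear: "(B - B') * T ^ 2 + (A - A' - (B - B') * (D + D')) * T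
      + (A' * D - A * D' + (B - B') * D * D') = 0"
    if eq: "A / (T - D) + B = A' / (T - D') + B'" and nz: "T - D \<noteq> 0" "T - D' \<noteq> 0"
    for A B A' B' T D D' :: "'p Fpbar"
  proof -
    have "A * (T - D') + B * (T - D) * (T - D') = (A / (T - D) + B) * ((T - D) * (T - D'))"
      using nz by (simp add: distrib_right)
    also have "\<dots> = A' * (T - D) + B' * (T - D) * (T - D')"
      unfolding eq using nz by (simp add: distrib_right)
    finally have "A * (T - D') + B * (T - D) * (T - D') - (A' * (T - D) + B' * (T - D) * (T - D')) = 0"
      by simp
    thus ?thesis by (simp add: algebra_simps power2_eq_square)
  qed
  show ?thesis
  proof (rule inj_onI)
    fix w w' assume mem: "w \<in> {a. a \<noteq> 0} \<times> UNIV" "w' \<in> {a. a \<noteq> 0} \<times> UNIV"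
      and "mobius t w = mobius t w'"
    moreover obtain a b c a' b' c' where w: "w = (a, b, c)" "w' = (a', b', c')"
      by (cases w, cases w')
    ultimately have a: "a \<noteq> 0" and a': "a' \<noteq> 0" and eq: "mobius t (a, b, c) = mobius t (a', b', c')"
      by auto
    have "a = a' \<and> b = b' \<and> c = c'"
    proof (cases c; cases c')
      assume c: "c = None" and c': "c' = None"
      have "to_ac 0 * t ^ 2 + to_ac (a - a') * t + to_ac (b - b') = 0"
        using eq by (simp add: c c' algebra_simps)
      from triv(2,3)[OF this] show ?thesis using c c' by simp
    next
      fix d assume "c = None" "c' = Some d"
      thus ?thesis using mixed[of a b a' d b'] eq a by simp
    next
      fix d assume "c = Some d" "c' = None"
      thus ?thesis using mixed[of a' b' a d b] eq a' by simp
    next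
      fix d d' assume c: "c = Some d" and c': "c' = Some d'"
      have "to_ac a / (t - to_ac d) + to_ac b = to_ac a' / (t - to_ac d') + to_ac b'"
        using eq by (simp add: c c')
      from clear[OF this ne ne]
      have rel: "to_ac (b - b') * t ^ 2 + to_ac (a - a' - (b - b') * (d + d')) * t
          + to_ac (a' * d - a * d' + (b - b') * d * d') = 0"
        by (simp only: to_ac_add to_ac_diff to_ac_mult)
      have "b = b'" using triv(1)[OF rel] by simp
      moreover have "a = a'" using triv(2)[OF rel] \<open>b = b'\<close> by simp
      moreover have "d = d'" using triv(3)[OF rel] \<open>b = b'\<close> \<open>a = a'\<close> a by (simp add: mult.commute[of d a])
      ultimately show ?thesis by (simp add: c c')
    qed
    thus "w = w'" using w by simp
  qed
qed

section \<open>Roots of \<open>gamma z\<close> and \<open>tau z\<close> in the closure\<close>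

interpretation to_ac: map_poly_inj_idom_hom "to_ac :: 'a :: Fields.field \<Rightarrow> 'a alg_closure"
  by unfold_locales simp_all

text \<open>For \<open>z\<close> nonzero, being a root thus means
  \<open>frob 1 t = - (t + 1) / (t + 1 + to_ac z)\<close>: Frobenius acts on \<open>t\<close> as the
  Moebius map with matrix rows \<open>(-1, -1)\<close> and \<open>(1, 1 + z)\<close>.\<close>

lemma poly_map_to_ac_gamma:
  "poly (map_poly to_ac (gamma z)) t = frob 1 t * (t + 1 + to_ac z) + (t + 1)"
  by (simp add: gamma_def frob_def hom_distribs algebra_simps)

lemma poly_map_to_ac_tau:
  fixes x :: "'p :: prime_card Fpbar"
  shows "poly (map_poly to_ac (tau z)) x
    = poly (map_poly to_ac (gamma z)) ((frob 1 x - x) ^ (CARD('p) - 1))"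
  by (simp add: tau_def frob_def hom_distribs poly_pcompose)

lemma Q_hat_if_gamma_root:
  assumes root: "poly (map_poly to_ac (gamma z)) t = 0" and t: "t \<notin> range to_ac" and z: "z \<noteq> 0"
  shows "t \<in> Q_hat z"
proof -
  define Z where "Z = to_ac z"
  define t0 t1 t2 t3 where "t0 = t" "t1 = frob 1 t" "t2 = frob 2 t" "t3 = frob 3 t"
  note defs = this
  have Z: "Z \<noteq> 0" using z by (simp add: Z_def)
  have e: "frob 1 t * (t + 1 + Z) + (t + 1) = 0"
    using root by (simp add: poly_map_to_ac_gamma Z_def)
  have "frob i (frob 1 t * (t + 1 + Z) + (t + 1)) = 0" for i by (simp only: e frob_zero_iff)
  hence "frob (i + 1) t * (frob i t + 1 + Z) + (frob i t + 1) = 0" for i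
    by (simp only: frob_add frob_mult frob_one frob_frob frob_to_ac Z_def)
  from this[of 0] this[of 1] this[of 2]
  have e0: "t1 * (t0 + 1 + Z) + (t0 + 1) = 0" and e1: "t2 * (t1 + 1 + Z) + (t1 + 1) = 0"
    and e2: "t3 * (t2 + 1 + Z) + (t2 + 1) = 0"
    by (simp_all add: defs numeral_2_eq_2 numeral_3_eq_3)
  \<comment> \<open>A vanishing denominator would also force \<open>x + 1 = 0\<close>, hence
    \<open>Z = 0\<close>.\<close>
  have nz: "x + 1 + Z \<noteq> 0" if "y * (x + 1 + Z) + (x + 1) = 0" for x y
  proof
    assume "x + 1 + Z = 0"
    with that Z show False by simp
  qed
  have ne: "t0 - t1 \<noteq> 0"
    using t frob_1_eq_iff[of t] by (auto simp: defs)
  have "frob 2 (t0 - t1) \<noteq> 0" using ne by (simp only: frob_zero_iff)  simp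
  hence ne2: "t2 - t3 \<noteq> 0" by (simp add: defs numeral_2_eq_2 numeral_3_eq_3)
  \<comment> \<open>The next three identities come from subtracting consecutive relations among
    \<open>e0\<close>, \<open>e1\<close>, \<open>e2\<close>; for \<open>h3\<close> they are
    cross-multiplied first. They express the differences in \<open>nu_one\<close> through
    \<open>t0 - t1\<close> and \<open>t1 - t2\<close>.\<close>
  have h1: "(t0 - t2) * (t1 + 1 + Z) = Z * (t0 - t1)"
  proof -
    have "(t0 - t2) * (t1 + 1 + Z) - Z * (t0 - t1)
      = (t1 * (t0 + 1 + Z) + (t0 + 1)) - (t2 * (t1 + 1 + Z) + (t1 + 1))"
      by (simp add: algebra_simps)
    thus ?thesis using e0 e1 by simp
  qed
  have h2: "(t1 - t3) * (t2 + 1 + Z) = Z * (t1 - t2)"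
  proof -
    have "(t1 - t3) * (t2 + 1 + Z) - Z * (t1 - t2)
      = (t2 * (t1 + 1 + Z) + (t1 + 1)) - (t3 * (t2 + 1 + Z) + (t2 + 1))"
      by (simp add: algebra_simps)
    thus ?thesis using e1 e2 by simp
  qed
  have h3: "(t2 - t3) * (t1 + 1 + Z) * (t2 + 1 + Z) = - (Z * (t1 - t2))"
  proof -
    have "(t2 - t3) * (t1 + 1 + Z) * (t2 + 1 + Z) + Z * (t1 - t2)
      = (t2 * (t1 + 1 + Z) + (t1 + 1)) * (t2 + 1 + Z) - (t3 * (t2 + 1 + Z) + (t2 + 1)) * (t1 + 1 + Z)"
      by (simp add: algebra_simps)
    thus ?thesis using e1 e2 by (simp add: eq_neg_iff_add_eq_0)
  qed
  \<comment> \<open>After multiplication by both denominators the two summands become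
    \<open>Z * Z * (t0 - t1) * (t1 - t2)\<close> and its negative.\<close>
  have "((t0 - t2) * (t1 - t3) + Z * ((t0 - t1) * (t2 - t3))) * ((t1 + 1 + Z) * (t2 + 1 + Z))
      = ((t0 - t2) * (t1 + 1 + Z)) * ((t1 - t3) * (t2 + 1 + Z))
        + Z * (t0 - t1) * ((t2 - t3) * (t1 + 1 + Z) * (t2 + 1 + Z))"
    by (simp only: distrib_right mult.assoc mult.left_commute mult.commute)
  also have "\<dots> = 0" unfolding h1 h2 h3 by simp
  finally have "(t0 - t2) * (t1 - t3) + Z * ((t0 - t1) * (t2 - t3)) = 0"
    using nz[OF e1] nz[OF e2] by simp
  hence "- ((t0 - t2) * (t1 - t3)) = Z * ((t0 - t1) * (t2 - t3))"
    by (metis minus_unique)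
  hence "- ((t0 - t2) * (t1 - t3)) / ((t0 - t1) * (t2 - t3)) = Z"
    using ne ne2 by simp
  thus ?thesis using t by (simp add: Q_hat_def nu_one Z_def defs)
qed

text \<open>With \<open>u = frob 1 x - x\<close> and \<open>v = u ^ (p - 1) = frob 1 u / u\<close>,
  the formula \<open>nu_one\<close> becomes \<open>- (1 + v) * (1 + v ^ p) / v ^ p\<close>. Setting
  this equal to \<open>z\<close> is exactly the equation \<open>gamma z = 0\<close> at
  \<open>v\<close>, which explains the shape of \<open>gamma\<close> and of
  \<open>tau\<close>.\<close>

lemma Q_hat_subset_ac_roots_tau: "Q_hat z \<subseteq> ac_roots (tau z)"
proof
  fix x :: "'a Fpbar"
  assume x: "x \<in> Q_hat z"
  define u v Z where "u = frob 1 x - x" "v = u ^ (CARD('a) - 1)" "Z = to_ac z"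
  note defs = this
  have u: "u \<noteq> 0" using x by (simp add: defs Q_hat_def flip: frob_1_eq_iff)
  have "CARD('a) = Suc (CARD('a) - 1)" by simp
  hence "u ^ CARD('a) = v * u"
    unfolding defs(2) by (metis power_Suc2)
  hence v: "v * u = frob 1 u" by (simp add: frob_def)
  hence "frob 1 (v * u) = frob 1 (frob 1 u)" by simp
  hence v2: "frob 1 v * frob 1 u = frob 2 u" by (simp add: numeral_2_eq_2)
  have sub: "x - frob 2 x = - (u + frob 1 u)" "frob 1 x - frob 3 x = - (frob 1 u + frob 2 u)"
    "x - frob 1 x = - u" "frob 2 x - frob 3 x = - frob 2 u"
    by (simp_all add: defs(1) numeral_2_eq_2 numeral_3_eq_3)
  have "- ((u + frob 1 u) * (frob 1 u + frob 2 u)) / (u * frob 2 u) = Z"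
    using x unfolding Q_hat_def nu_one mem_Collect_eq sub defs(3) minus_mult_minus by blast
  hence nu: "- ((u + frob 1 u) * (frob 1 u + frob 2 u)) = Z * (u * frob 2 u)"
    using u by (subst (asm) nonzero_divide_eq_eq) simp_all
  have "(frob 1 v * (v + 1 + Z) + (v + 1)) * (u * frob 1 u)
      = (frob 1 v * frob 1 u) * (v * u + u + Z * u) + (v * u + u) * frob 1 u"
    by (simp add: algebra_simps)
  also have "\<dots> = (u + frob 1 u) * (frob 1 u + frob 2 u) + Z * (u * frob 2 u)"
    unfolding v v2 by (simp add: algebra_simps)
  also have "\<dots> = 0" unfolding nu[symmetric] by simp
  finally have "frob 1 v * (v + 1 + Z) + (v + 1) = 0" using u by simp
  thus "x \<in> ac_roots (tau z)"
    by (simp add: ac_roots_def poly_map_to_ac_tau poly_map_to_ac_gamma defs)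
qed

section \<open>Counting the roots of \<open>tau z\<close>\<close>

lemma gamma_monom:
  fixes z :: "'p :: prime_card Fp"
  shows "gamma z = monom 1 (CARD('p) + 1) + (smult (1 + z) (monom 1 CARD('p)) + [:1, 1:])"
proof -
  have "[:0, 1:] + 1 = ([:1, 1:] :: 'p Fp poly)" by (simp only: one_pCons add_pCons) simp
  thus ?thesis by (simp only: gamma_def monom_altdef smult_1_left add.assoc)
qed

lemma degree_gamma: "Polynomial.degree (gamma (z :: 'p :: prime_card Fp)) = CARD('p) + 1"
proof -
  have p: "CARD('p) \<ge> 2" using prime_card prime_ge_2_nat by blast
  have "Polynomial.degree (smult (1 + z) (monom 1 CARD('p)) + [:1, 1:]) \<le> CARD('p)"
    using p by (intro degree_add_le) (auto simp: degree_monom_eq intro: order.trans[OF degree_smult_le])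
  thus ?thesis unfolding gamma_monom
    by (subst degree_add_eq_left) (auto simp: degree_monom_eq)
qed

text \<open>The inner polynomial vanishes at 0 and \<open>gamma z\<close> takes the value 1
  there.\<close>

lemma tau_nonzero: "tau (z :: 'p :: prime_card Fp) \<noteq> 0"
proof
  assume "tau z = 0"
  hence "poly (tau z) 0 = 0" by simp
  moreover have "CARD('p) - 1 \<noteq> 0"
    using prime_gt_1_nat[OF prime_card[where 'a = 'p]] by linarith
  ultimately show False
    by (simp add: tau_def poly_pcompose poly_gamma power_0_left)
qed

lemma card_ac_roots_le:
  assumes "f \<noteq> 0"
  shows "finite (ac_roots f)" "card (ac_roots f) \<le> Polynomial.degree f"
proof -
  have "map_poly to_ac f \<noteq> 0" using assms by simp
  from card_poly_roots_bound[OF this] poly_roots_finite[OF this]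
  show "finite (ac_roots f)" "card (ac_roots f) \<le> Polynomial.degree f"
    by (simp_all add: ac_roots_def)
qed

lemma Q_hat_orbit:
  fixes z :: "'p :: prime_card Fp"
  assumes t: "t \<in> Q_hat z" and z: "z \<noteq> 0"
  shows "ac_roots (tau z) = mobius t ` ({a. a \<noteq> 0} \<times> UNIV)"
    and "Q_hat z = mobius t ` ({a. a \<noteq> 0} \<times> UNIV)"
proof -
  let ?M = "mobius t ` ({a. a \<noteq> 0} \<times> UNIV)"
  have sub: "?M \<subseteq> Q_hat z"
  proof clarify
    fix a b c assume "(a :: 'p Fp) \<noteq> 0"
    thus "mobius t (a, b, c) \<in> Q_hat z"
      using t Q_hat_mobius[OF t] by (cases c) (simp_all add: Q_hat_affine_iff)
  qed
  have "card {a :: 'p Fp. a \<noteq> 0} = CARD('p) - 1"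
  proof -
    have "{a :: 'p Fp. a \<noteq> 0} = UNIV - {0}" by auto
    thus ?thesis by (simp add: card_Diff_singleton)
  qed
  \<comment> \<open>The factor \<open>p + 1\<close> counts the possible poles, including
    \<open>None\<close>.\<close>
  hence "card ({a :: 'p Fp. a \<noteq> 0} \<times> (UNIV :: ('p Fp \<times> 'p Fp option) set))
      = (CARD('p) - 1) * (CARD('p) * (CARD('p) + 1))"
    by (simp add: card_cartesian_product card_UNIV_option flip: UNIV_Times_UNIV)
  hence card: "card ?M = (CARD('p) - 1) * (CARD('p) * (CARD('p) + 1))"
    using inj_on_mobius[OF Q_hat_frob_2[OF t z]] by (simp add: card_image)
  have "Polynomial.degree ([:0, 1:] ^ CARD('p) - [:0, 1:] :: 'p Fp poly) \<le> CARD('p)"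
    using prime_gt_0_nat[OF prime_card[where 'a = 'p]]
    by (intro degree_diff_le) (auto simp: degree_power_eq)
  hence "Polynomial.degree (([:0, 1:] ^ CARD('p) - [:0, 1:] :: 'p Fp poly) ^ (CARD('p) - 1))
      \<le> CARD('p) * (CARD('p) - 1)"
    by (intro order.trans[OF degree_power_le]) simp
  hence "Polynomial.degree (tau z) \<le> (CARD('p) + 1) * (CARD('p) * (CARD('p) - 1))"
    unfolding tau_def degree_pcompose degree_gamma by (rule mult_left_mono) simp
  also have "\<dots> = card ?M" unfolding card by (simp only: mult.commute mult.left_commute)
  \<comment> \<open>The orbit lies in \<open>Q_hat z\<close>, which lies in the root set of
    \<open>tau z\<close>; this bound makes all three coincide.\<close>
  finally have "card (ac_roots (tau z)) \<le> card ?M"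
    using card_ac_roots_le(2)[OF tau_nonzero, of z] by simp
  hence "?M = ac_roots (tau z)"
    using sub Q_hat_subset_ac_roots_tau[of z]
    by (intro card_seteq card_ac_roots_le tau_nonzero) auto
  thus "ac_roots (tau z) = ?M" "Q_hat z = ?M"
    using sub Q_hat_subset_ac_roots_tau[of z] by auto
qed

text \<open>Each of the two elements is a Moebius image of the other, and Frobenius fixes the
  coefficients. Hence any single element of \<open>Q_hat z\<close> determines the order of
  appearance.\<close>

lemma Q_hat_frob_fixed:
  assumes "t \<in> Q_hat z" "x \<in> Q_hat z" "z \<noteq> 0" "frob k t = t"
  shows "frob k x = x"
proof -
  obtain a b c where "x = mobius t (a, b, c)"
    using Q_hat_orbit(2)[OF assms(1,3)] assms(2) by auto
  thus ?thesis using assms(4) by (cases c) simp_all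
qed

section \<open>The order of appearance as a Frobenius period\<close>

lemma nu_homogeneous:
  assumes "y \<noteq> 0"
  shows "nu x y = nu (x / y) 1"
proof -
  have "bracket x y i j = bracket (x / y) 1 i j * (frob i y * frob j y)" for i j
    using assms by (simp add: bracket_def frob_def power_divide field_simps)
  \<comment> \<open>The index pairs 02, 13 above and 01, 23 below each cover 0 to 3 once, so the
    conjugates of \<open>y\<close> cancel.\<close>
  thus ?thesis using assms by (simp add: nu_def)
qed

text \<open>A pair \<open>x\<close>, \<open>y\<close> in the field yields the element
  \<open>x / y\<close> of \<open>Q_hat z\<close>; conversely an element \<open>x\<close> yields the
  pair \<open>x\<close>, \<open>1\<close>.\<close>

lemma f_poly_root_iff:
  fixes z :: "'p :: prime_card Fp"
  assumes "m \<ge> 1" "z \<noteq> 0"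
  shows "poly (f_poly m) (to_ac z) = 0 \<longleftrightarrow> (\<exists>x \<in> Q_hat z. frob m x = x)"
proof -
  \<comment> \<open>Finiteness matters because a product over an infinite index set would default to
    1 and have no roots.\<close>
  have "finite (subfield_of_degree m :: 'p Fpbar set)"
    by (rule card_ge_0_finite) (simp add: card_subfield_of_degree[OF assms(1)])
  hence "finite ((\<lambda>(x, y). nu x y) ` (subfield_of_degree m \<times> subfield_of_degree m :: ('p Fpbar \<times> 'p Fpbar) set))"
    by simp
  hence "finite (Z_set m :: 'p Fpbar set)"
    by (rule finite_subset[rotated]) (auto simp: Z_set_def)
  hence "poly (f_poly m) (to_ac z) = 0 \<longleftrightarrow> to_ac z \<in> Z_set m"
    using assms(2) by (auto simp: f_poly_def poly_prod)
  also have "\<dots> \<longleftrightarrow> (\<exists>x \<in> Q_hat z. frob m x = x)"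
  proof
    assume "to_ac z \<in> Z_set m"
    then obtain x y where xy: "to_ac z = nu x y" "frob m x = x" "frob m y = y" "lin_indep x y"
      by (auto simp: Z_set_def subfield_of_degree_iff)
    have y: "y \<noteq> 0" using xy(4) by (auto simp: lin_indep_def Fp.dependent_zero)
    have "x / y \<notin> range to_ac"
    proof
      assume "x / y \<in> range to_ac"
      then obtain a where "x / y = to_ac a" by auto
      hence "to_ac 1 * x + to_ac (- a) * y = 0" using y by (simp add: field_simps)
      thus False using xy(4) unfolding lin_indep_iff by (metis one_neq_zero)
    qed
    hence "x / y \<in> Q_hat z" using xy(1) nu_homogeneous[OF y, of x] by (simp add: Q_hat_def)
    thus "\<exists>x \<in> Q_hat z. frob m x = x" using xy by (intro bexI[of _ "x / y"]) simp_all
  next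
    assume "\<exists>x \<in> Q_hat z. frob m x = x"
    then obtain x where x: "x \<in> Q_hat z" "frob m x = x" by auto
    have "lin_indep x 1" unfolding lin_indep_iff
    proof (intro allI impI)
      fix a b assume eq: "to_ac a * x + to_ac b * 1 = 0"
      have "a = 0"
      proof (rule ccontr)
        assume "a \<noteq> 0"
        hence "x = to_ac (- b / a)" using eq by (simp add: field_simps eq_neg_iff_add_eq_0)
        hence "x \<in> range to_ac" by blast
        thus False using x(1) by (simp add: Q_hat_def)
      qed
      thus "a = 0 \<and> b = 0" using eq by simp
    qed
    thus "to_ac z \<in> Z_set m" unfolding Z_set_def
      using x by (simp add: Q_hat_def subfield_of_degree_iff) (metis frob_one)
  qed
  finally show ?thesis .
qed

lemma order_of_appearance_eq:
  assumes "t \<in> Q_hat z" "z \<noteq> 0"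
  shows "order_of_appearance z = (LEAST m. m \<ge> 1 \<and> frob m t = t)"
proof -
  have "poly (f_poly m) (to_ac z) = 0 \<longleftrightarrow> frob m t = t" if "m \<ge> 1" for m
    using f_poly_root_iff[OF that assms(2)] Q_hat_frob_fixed assms by blast
  hence "(m \<ge> 1 \<and> poly (f_poly m) (to_ac z) = 0) = (m \<ge> 1 \<and> frob m t = t)" for m by blast
  thus ?thesis unfolding order_of_appearance_def by simp
qed

section \<open>Degrees of irreducible polynomials over the prime field\<close>

lemma irreducible_dvd_if_common_root:
  fixes q f :: "'p :: prime_card Fp poly"
  assumes "Factorial_Ring.irreducible q" "poly (map_poly to_ac q) t = 0" "poly (map_poly to_ac f) t = 0"
  shows "q dvd f"
proof (rule ccontr)
  assume "\<not> q dvd f"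
  hence "Rings.coprime q f"
    using assms(1) by (metis irreducible_imp_prime_elem prime_elem_imp_coprime)
  then obtain a b where "a * q + b * f = 1"
    by (metis bezout_coefficients_fst_snd coprime_imp_gcd_eq_1)
  \<comment> \<open>Evaluating the Bezout identity at the common root turns it into
    \<open>0 = 1\<close>.\<close>
  hence "poly (map_poly to_ac (a * q + b * f)) t = 1" by simp
  thus False using assms(2,3) by (simp add: hom_distribs)
qed

text \<open>Having the root \<open>t\<close>, \<open>q\<close> divides
  \<open>X ^ (p ^ k) - X\<close> exactly when \<open>frob k t = t\<close>. By the facts behind
  distinct-degree factorization, the least positive such \<open>k\<close> is the degree of
  \<open>q\<close>.\<close>

lemma degree_irreducible:
  fixes q :: "'p :: prime_card Fp poly"
  assumes q: "Factorial_Ring.irreducible q" and t: "poly (map_poly to_ac q) t = 0"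
  shows "Polynomial.degree q = (LEAST m. m \<ge> 1 \<and> frob m t = t)"
proof -
  define D where "D = (\<lambda>k. monom 1 1 ^ (CARD('p) ^ k) - monom 1 1 :: 'p Fp poly)"
  have "poly (map_poly to_ac (D k)) t = frob k t - t" for k
    by (simp add: D_def hom_distribs frob_def poly_monom)
  moreover have "q dvd D k \<longleftrightarrow> poly (map_poly to_ac (D k)) t = 0" for k
    using irreducible_dvd_if_common_root[OF q t, of "D k"] t
    by (auto elim!: dvdE simp: to_ac.hom_mult)
  ultimately have iff: "q dvd D k \<longleftrightarrow> frob k t = t" for k by simp
  show ?thesis
  proof (rule Least_equality[symmetric])
    have "Polynomial.degree q \<noteq> 0"
      using q by (metis degree_eq_zeroE irreducible_const_poly_iff Factorial_Ring.irreducible_def is_unit_const_poly_iff dvd_field_iff pCons_0_0)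
    moreover have "frob (Polynomial.degree q) t = t"
      using degree_divisor1[OF q refl] iff by (simp add: D_def)
    ultimately show "Polynomial.degree q \<ge> 1 \<and> frob (Polynomial.degree q) t = t" by simp
  next
    fix k assume "k \<ge> 1 \<and> frob k t = t"
    thus "Polynomial.degree q \<le> k"
      using degree_divisor2[OF q refl, of k] iff[of k] unfolding D_def by (meson not_le)
  qed
qed

section \<open>Prime field roots of \<open>gamma z\<close> and their removal in
  \<open>gamma_bar z\<close>\<close>

lemma two_nonzero_mod_ring:
  assumes "odd CARD('p :: prime_card)"
  shows "(2 :: 'p Fp) \<noteq> 0"
proof
  assume "(2 :: 'p Fp) = 0"
  hence "of_nat 2 = (0 :: 'p Fp)" by simp
  hence "CARD('p) dvd 2" by (simp only: of_nat_0_mod_ring_dvd)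
  hence "CARD('p) \<le> 2" by (rule dvd_imp_le) simp
  moreover have "CARD('p) > 1" using prime_card prime_gt_1_nat by blast
  ultimately show False using assms by (cases "CARD('p) = 2") auto
qed

text \<open>On the prime field \<open>gamma z\<close> agrees with
  \<open>X^2 + (z + 2) X + 1\<close>, whose discriminant is \<open>z ^ 2 + 4 * z\<close>; this
  completes the square.\<close>

lemma gamma_root_discriminant:
  assumes "poly (gamma z) r = 0"
  shows "(2 * r + (z + 2)) ^ 2 = z ^ 2 + 4 * z"
proof -
  have "(2 * r + (z + 2)) ^ 2 = 4 * poly (gamma z) r + (z ^ 2 + 4 * z)"
    unfolding poly_gamma by (simp add: power2_eq_square algebra_simps)
  thus ?thesis using assms by simp
qed

text \<open>This packages the cases of the definition of \<open>gamma_bar\<close>, with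
  \<open>h\<close> being \<open>X - 1\<close>, the quadratic or 1, so that later arguments need no
  case distinction.\<close>

lemma gamma_bar_cofactor:
  fixes z :: "'p :: prime_card Fp"
  assumes "odd CARD('p)" "z \<noteq> 0"
  obtains h where "gamma z = gamma_bar z * h" "Polynomial.degree h \<le> 2"
    "\<And>r. poly (gamma z) r = 0 \<Longrightarrow> poly h r = 0"
proof -
  consider "z = -4" | "z \<noteq> -4" "is_square (z ^ 2 + 4 * z)" | "z \<noteq> -4" "\<not> is_square (z ^ 2 + 4 * z)"
    by blast
  thus thesis
  proof cases
    case 1
    have "r = 1" if "poly (gamma z) r = 0" for r
    proof -
      have "(r - 1) ^ 2 = poly (gamma z) r"
        unfolding poly_gamma 1 by (simp add: power2_eq_square algebra_simps)
      thus ?thesis using that by simp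
    qed
    moreover have "gamma_bar z = gamma z div [:-1, 1:]"
      using 1 assms(2) by (simp add: gamma_bar_def)
    hence "gamma z = gamma_bar z * [:-1, 1:]"
      using gamma_bar_exact(1)[OF assms(1) 1] by (simp only: dvd_div_mult_self)
    ultimately show thesis by (intro that[of "[:-1, 1:]"]) auto
  next
    case 2
    have "poly [:1, z + 2, 1:] r = poly (gamma z) r" for r
      by (simp add: poly_gamma power2_eq_square algebra_simps)
    moreover have "gamma_bar z = gamma z div [:1, z + 2, 1:]"
      using 2 assms(2) by (simp add: gamma_bar_def)
    hence "gamma z = gamma_bar z * [:1, z + 2, 1:]"
      using gamma_bar_exact(2)[OF assms 2] by (simp only: dvd_div_mult_self)
    ultimately show thesis by (intro that[of "[:1, z + 2, 1:]"]) simp_all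
  next
    case 3
    have "poly (gamma z) r \<noteq> 0" for r
      using gamma_root_discriminant[of z r] 3(2) is_nth_powerI by metis
    thus thesis using assms 3
      by (intro that[of 1]) (simp_all add: gamma_bar_def)
  qed
qed

lemma degree_gamma_bar_pos:
  fixes z :: "'p :: prime_card Fp"
  assumes "odd CARD('p)" "z \<noteq> 0"
  shows "Polynomial.degree (gamma_bar z) > 0"
proof -
  obtain h where h: "gamma z = gamma_bar z * h" "Polynomial.degree h \<le> 2"
    using gamma_bar_cofactor[OF assms] by metis
  \<comment> \<open>The total degree \<open>p + 1\<close> is at least 3, while the cofactor takes at
    most 2 of it.\<close>
  have "CARD('p) + 1 \<le> Polynomial.degree (gamma_bar z) + Polynomial.degree h"
    using degree_mult_le[of "gamma_bar z" h] by (simp flip: h(1) add: degree_gamma)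
  moreover have "CARD('p) > 1" using prime_card prime_gt_1_nat by blast
  ultimately show ?thesis using h(2) by linarith
qed

text \<open>In characteristic \<open>p\<close> the derivative is \<open>X ^ p + 1\<close>.\<close>

lemma poly_pderiv_gamma: "poly (pderiv (gamma z)) r = r + 1"
  by (simp add: gamma_monom pderiv_add pderiv_smult pderiv_monom pderiv_pCons poly_monom Fp_power_CARD
      of_nat_0_mod_ring_dvd)

text \<open>Such a root would also be a root of the cofactor, hence a double root of
  \<open>gamma z\<close>. The derivative then forces \<open>r = -1\<close>, where
  \<open>gamma z\<close> has the value \<open>- z\<close>.\<close>

lemma gamma_bar_no_rational_root:
  fixes z :: "'p :: prime_card Fp"
  assumes "odd CARD('p)" "z \<noteq> 0"
  shows "poly (gamma_bar z) r \<noteq> 0"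
proof
  assume root: "poly (gamma_bar z) r = 0"
  obtain h where h: "gamma z = gamma_bar z * h"
    and hr: "\<And>r. poly (gamma z) r = 0 \<Longrightarrow> poly h r = 0"
    using gamma_bar_cofactor[OF assms] by metis
  have g: "poly (gamma z) r = 0" using root by (simp add: h)
  have "poly (pderiv (gamma z)) r = 0"
    unfolding h pderiv_mult using root hr[OF g] by simp
  hence "r = -1" by (simp add: poly_pderiv_gamma eq_neg_iff_add_eq_0)
  thus False using g assms(2) by (simp add: poly_gamma)
qed

lemma poly_map_to_ac_to_ac [simp]: "poly (map_poly to_ac f) (to_ac r) = to_ac (poly f r)"
  by (simp add: to_ac.base.poly_map_poly)

lemma ac_roots_gamma_bar:
  fixes z :: "'p :: prime_card Fp"
  assumes "odd CARD('p)" "z \<noteq> 0"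
  shows "ac_roots (gamma_bar z) \<subseteq> ac_roots (gamma z)" "ac_roots (gamma_bar z) \<subseteq> Q_hat z"
proof -
  obtain h where h: "gamma z = gamma_bar z * h"
    using gamma_bar_cofactor[OF assms] by metis
  thus sub: "ac_roots (gamma_bar z) \<subseteq> ac_roots (gamma z)"
    by (auto simp: ac_roots_def to_ac.hom_mult)
  show "ac_roots (gamma_bar z) \<subseteq> Q_hat z"
  proof
    fix t assume t: "t \<in> ac_roots (gamma_bar z)"
    have "t \<notin> range to_ac"
      using t gamma_bar_no_rational_root[OF assms] by (auto simp: ac_roots_def)
    thus "t \<in> Q_hat z"
      using t sub assms(2) by (intro Q_hat_if_gamma_root) (auto simp: ac_roots_def)
  qed
qed

lemma ac_roots_nonempty:
  assumes "Polynomial.degree f > 0"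
  shows "ac_roots f \<noteq> {}"
proof -
  have "Polynomial.degree (map_poly to_ac f) > 0" using assms by simp
  from alg_closed_imp_poly_has_root[OF this] show ?thesis by (auto simp: ac_roots_def)
qed

text \<open>A root \<open>t\<close> of \<open>q\<close> lies in \<open>Q_hat z\<close>, so the
  degree and the order of appearance are both the least positive \<open>k\<close> with
  \<open>frob k t = t\<close>.\<close>

lemma degree_factor_gamma_bar:
  fixes z :: "'p :: prime_card Fp"
  assumes "odd CARD('p)" "z \<noteq> 0"
    and q: "Factorial_Ring.irreducible q" "q dvd gamma_bar z"
  shows "Polynomial.degree q = order_of_appearance z"
proof -
  have "Polynomial.degree q > 0"
    using q(1) by (metis Factorial_Ring.irreducible_def gr0I is_unit_iff_degree)
  then obtain t where t: "t \<in> ac_roots q" using ac_roots_nonempty by blast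
  hence "t \<in> ac_roots (gamma_bar z)"
    using q(2) by (auto simp: ac_roots_def to_ac.hom_mult elim!: dvdE)
  hence "t \<in> Q_hat z" using ac_roots_gamma_bar(2)[OF assms(1,2)] by blast
  thus ?thesis
    using degree_irreducible[OF q(1), of t] t order_of_appearance_eq[of t z] assms(2)
    by (simp add: ac_roots_def)
qed

section \<open>Splitting fields\<close>

lemma generate_field_closed:
  fixes H :: "'a :: Fields.field set"
  defines "K \<equiv> generate_field ring_of_type_algebra H"
  shows "x \<in> K \<Longrightarrow> y \<in> K \<Longrightarrow> x + y \<in> K"
    and "x \<in> K \<Longrightarrow> y \<in> K \<Longrightarrow> x - y \<in> K"
    and "x \<in> K \<Longrightarrow> y \<in> K \<Longrightarrow> x * y \<in> K"
    and "x \<in> K \<Longrightarrow> y \<in> K \<Longrightarrow> x / y \<in> K"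
proof -
  interpret R: Ring.field "ring_of_type_algebra :: 'a ring" by (rule field_from_type_algebra)
  have neg: "\<ominus>\<^bsub>ring_of_type_algebra\<^esub> x = - x" for x :: 'a
    by (rule sym, rule R.sum_zero_eq_neg) (auto simp: ring_of_type_algebra_def)
  note ops = ring_of_type_algebra_def
  show add: "x \<in> K \<Longrightarrow> y \<in> K \<Longrightarrow> x + y \<in> K" for x y
    using generate_field.eng_add[of x ring_of_type_algebra H y] by (simp add: K_def ops)
  show mult: "x \<in> K \<Longrightarrow> y \<in> K \<Longrightarrow> x * y \<in> K" for x y
    using generate_field.eng_mult[of x ring_of_type_algebra H y] by (simp add: K_def ops)
  have "- y \<in> K" if "y \<in> K" for y
    using generate_field.a_inv[of y ring_of_type_algebra H] that by (simp add: K_def neg)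
  from add[OF _ this] show "x \<in> K \<Longrightarrow> y \<in> K \<Longrightarrow> x - y \<in> K" by simp
  have zero: "0 \<in> K" using R.zero_in_generate[of H] by (simp add: K_def ops)
  have "inverse y \<in> K" if "y \<in> K" for y
  \<comment> \<open>Since \<open>inverse 0 = 0\<close>, closure under division holds without a side
    condition.\<close>
  proof (cases "y = 0")
    case False
    thus ?thesis using generate_field.m_inv[of y ring_of_type_algebra H] that
      by (simp add: K_def ring_of_type_inv) (simp add: ops)
  qed (simp add: zero)
  from mult[OF _ this] show "x \<in> K \<Longrightarrow> y \<in> K \<Longrightarrow> x / y \<in> K"
    by (simp add: field_class.field_divide_inverse)
qed

lemma splitting_field_subset:
  assumes "ac_roots f \<subseteq> splitting_field g"
  shows "splitting_field f \<subseteq> splitting_field g"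
proof
  interpret R: Ring.field "ring_of_type_algebra :: 'a Fpbar ring" by (rule field_from_type_algebra)
  fix x assume "x \<in> splitting_field f"
  moreover have "range to_ac \<subseteq> splitting_field g"
    by (auto simp: splitting_field_def intro: generate_field.incl)
  ultimately show "x \<in> splitting_field g"
    using R.generate_field_min_subfield1[of "range to_ac \<union> ac_roots f" "splitting_field g"]
      R.generate_field_is_subfield[of "range to_ac \<union> ac_roots g"] assms
    by (auto simp: splitting_field_def ring_of_type_algebra_def)
qed

text \<open>Roots of \<open>gamma z\<close> are in the prime field or are roots of
  \<open>tau z\<close>. Conversely, every root of \<open>tau z\<close> is a Moebius image of one
  root of \<open>gamma_bar z\<close>.\<close>

lemma splitting_field_gamma_eq_tau:
  fixes z :: "'p :: prime_card Fp"
  assumes "odd CARD('p)" "z \<noteq> 0"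
  shows "splitting_field (gamma z) = splitting_field (tau z)"
proof (rule equalityI; rule splitting_field_subset; rule subsetI)
  fix t assume t: "t \<in> ac_roots (gamma z)"
  show "t \<in> splitting_field (tau z)"
  proof (cases "t \<in> range to_ac")
    case False
    hence "t \<in> Q_hat z" using t assms(2) by (intro Q_hat_if_gamma_root) (auto simp: ac_roots_def)
    hence "t \<in> ac_roots (tau z)" using Q_hat_subset_ac_roots_tau by blast
    thus ?thesis by (simp add: splitting_field_def generate_field.incl)
  qed (simp add: splitting_field_def generate_field.incl)
next
  fix x assume x: "x \<in> ac_roots (tau z)"
  obtain t where t: "t \<in> ac_roots (gamma_bar z)"
    using ac_roots_nonempty[OF degree_gamma_bar_pos[OF assms]] by blast
  hence tQ: "t \<in> Q_hat z" and tg: "t \<in> ac_roots (gamma z)"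
    using ac_roots_gamma_bar[OF assms] by auto
  obtain a b c where abc: "x = mobius t (a, b, c)"
    using x unfolding Q_hat_orbit(1)[OF tQ assms(2)] by auto
  have "to_ac a \<in> splitting_field (gamma z)" for a :: "'p Fp"
    by (simp add: splitting_field_def generate_field.incl)
  moreover have "t \<in> splitting_field (gamma z)"
    using tg by (simp add: splitting_field_def generate_field.incl)
  ultimately show "x \<in> splitting_field (gamma z)"
    unfolding abc splitting_field_def by (cases c) (simp_all add: generate_field_closed)
qed

section \<open>Distinct roots span distinct planes\<close>

lemma gamma_roots_affine:
  fixes t :: "'p :: prime_card Fpbar"
  assumes z: "z \<noteq> 0" and t: "t \<in> Q_hat z" "t \<in> ac_roots (gamma z)"
    and t': "to_ac a * t + to_ac b \<in> ac_roots (gamma z)" and a: "a \<noteq> 0"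
  shows "a = 1" "b = 0"
proof -
  \<comment> \<open>The identity eliminates \<open>y = frob 1 t\<close>: the first summand on the
    right is a multiple of the root equation of \<open>t\<close>, and the rest is a quadratic in
    \<open>x\<close> free of \<open>y\<close>, to which \<open>quadratic_relation_trivial\<close>
    applies.\<close>
  have id: "(A * y + B) * (A * x + B + 1 + Z) * (x + 1 + Z) + (A * x + B + 1) * (x + 1 + Z)
     = A * (y * (x + 1 + Z) + (x + 1)) * (A * x + B + 1 + Z)
       + (A * (B - A + 1) * x ^ 2
         + ((B - A) * (B + 1 + Z) + A * (B * (1 + Z) - A) + A * (1 + Z) + (B + 1)) * x
         + ((B * (1 + Z) - A) * (B + 1 + Z) + (B + 1) * (1 + Z)))"
    for A B Z x y :: "'p Fpbar"
    by (simp add: algebra_simps power2_eq_square)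
  have "frob 1 t * (t + 1 + to_ac z) + (t + 1) = 0"
    using t(2) by (simp add: ac_roots_def poly_map_to_ac_gamma)
  moreover have "(to_ac a * frob 1 t + to_ac b) * (to_ac a * t + to_ac b + 1 + to_ac z)
      + (to_ac a * t + to_ac b + 1) = 0"
    using t' by (simp add: ac_roots_def poly_map_to_ac_gamma)
  hence "((to_ac a * frob 1 t + to_ac b) * (to_ac a * t + to_ac b + 1 + to_ac z)
      + (to_ac a * t + to_ac b + 1)) * (t + 1 + to_ac z) = 0" by simp
  ultimately have "to_ac (a * (b - a + 1)) * t ^ 2
      + to_ac ((b - a) * (b + 1 + z) + a * (b * (1 + z) - a) + a * (1 + z) + (b + 1)) * t
      + to_ac ((b * (1 + z) - a) * (b + 1 + z) + (b + 1) * (1 + z)) = 0"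
    using id[of "to_ac a" "frob 1 t" "to_ac b" t "to_ac z"]
    by (simp only: distrib_right to_ac_add to_ac_mult to_ac_diff to_ac_1) simp
  note triv = quadratic_relation_trivial[OF Q_hat_frob_2[OF t(1) z] this]
  have "b - a + 1 = 0" using triv(1) a by simp
  moreover have "b = (b - a + 1) + (a - 1)" by simp
  ultimately have b: "b = a - 1" by simp
  have "z * ((a - 1) * (a + 1)) = 0"
    using triv(2) unfolding b by (simp add: algebra_simps)
  hence "a = 1 \<or> a + 1 = 0" using z by simp
  moreover have "z * ((a - 1) * (a + 1 + z)) = 0"
    using triv(3) unfolding b by (simp add: algebra_simps)
  hence "a = 1 \<or> a + 1 + z = 0" using z by simp
  \<comment> \<open>The alternatives \<open>a = -1\<close> and \<open>a = -1 - z\<close> exclude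
    each other because \<open>z\<close> is nonzero.\<close>
  ultimately show "a = 1" using z by auto
  thus "b = 0" using b by simp
qed

text \<open>Equal planes make \<open>t'\<close> an affine image of \<open>t\<close>, with nonzero
  slope because \<open>t'\<close> is outside the prime field.\<close>

lemma span_gamma_roots_distinct:
  fixes z :: "'p :: prime_card Fp"
  assumes z: "z \<noteq> 0" and t: "t \<in> Q_hat z" "t \<in> ac_roots (gamma z)"
    and t': "t' \<in> Q_hat z" "t' \<in> ac_roots (gamma z)" and span: "Fp.span {t, 1} = Fp.span {t', 1}"
  shows "t = t'"
proof -
  have "t' \<in> Fp.span {t, 1}" unfolding span by (intro Fp.span_base) simp
  then obtain a b where "t' - to_ac a * t = to_ac b * 1"
    by (auto simp: Fp.span_breakdown_eq Fp.span_singleton)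
  hence eq: "t' = to_ac a * t + to_ac b" by (simp add: algebra_simps)
  have "a \<noteq> 0"
  proof
    assume "a = 0"
    hence "t' \<in> range to_ac" using eq by simp
    thus False using t'(1) by (simp add: Q_hat_def)
  qed
  from gamma_roots_affine[OF z t t'(2)[unfolded eq] this] show ?thesis using eq by simp
qed

section \<open>Linear factors and the final assembly\<close>

lemma linear_factors_eq: "linear_factors f = {[:- r, 1:] | r. poly f r = 0}"
proof (intro equalityI subsetI)
  fix q assume "q \<in> linear_factors f"
  hence q: "q dvd f" "Polynomial.degree q = 1" "Polynomial.lead_coeff q = 1"
    by (auto simp: linear_factors_def)
  from degree1_coeffs[OF q(2)] obtain a b where ab: "q = [:b, a:]" by blast
  hence "q = [:- (- b), 1:]" using q(2,3) by (auto split: if_splits)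
  moreover from this have "poly f (- b) = 0" using q(1) by (metis poly_eq_0_iff_dvd)
  ultimately show "q \<in> {[:- r, 1:] | r. poly f r = 0}" by blast
qed (auto simp: linear_factors_def poly_eq_0_iff_dvd)

theorem theorem9p3:
  fixes z :: "'p :: prime_card Fp" and m :: nat
  assumes "odd CARD('p)"
    and "z \<noteq> 0"
    and "m = order_of_appearance z"
  shows
    "(\<forall>q. Factorial_Ring.irreducible q \<and> q dvd gamma_bar z \<longrightarrow> Polynomial.degree q = m) \<and>
     splitting_field (gamma z) = splitting_field (tau z) \<and>
     (ac_roots (gamma_bar z) \<subseteq> Q_hat z \<and>
      (\<forall>t \<in> ac_roots (gamma_bar z). \<forall>t' \<in> ac_roots (gamma_bar z).
         t \<noteq> t' \<longrightarrow> Fp.span {t, 1} \<noteq> Fp.span {t', 1})) \<and>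
     (\<not> is_square (z ^ 2 + 4 * z) \<longrightarrow> linear_factors (gamma z) = {}) \<and>
     (z = -4 \<longrightarrow> linear_factors (gamma z) = {[:-1, 1:]}) \<and>
     (z ^ 2 + 4 * z \<noteq> 0 \<longrightarrow>
        (\<forall>s. s ^ 2 = z ^ 2 + 4 * z \<longrightarrow>
           (let r_plus = (- (z + 2) + s) / 2; r_minus = (- (z + 2) - s) / 2 in
              r_plus \<noteq> r_minus \<and>
              linear_factors (gamma z) = {[:- r_plus, 1:], [:- r_minus, 1:]})))"
proof (intro conjI allI impI ballI)
  show "Polynomial.degree q = m"
    if "Factorial_Ring.irreducible q \<and> q dvd gamma_bar z" for q
    using degree_factor_gamma_bar assms that by blast
  show "splitting_field (gamma z) = splitting_field (tau z)"
    by (rule splitting_field_gamma_eq_tau) fact+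
  note roots = ac_roots_gamma_bar[OF assms(1,2)]
  show "ac_roots (gamma_bar z) \<subseteq> Q_hat z" by (rule roots(2))
  show "Fp.span {t, 1} \<noteq> Fp.span {t', 1}"
    if "t \<in> ac_roots (gamma_bar z)" "t' \<in> ac_roots (gamma_bar z)" "t \<noteq> t'" for t t'
    using span_gamma_roots_distinct[OF assms(2), of t t'] roots that by blast
  show "linear_factors (gamma z) = {}" if "\<not> is_square (z ^ 2 + 4 * z)"
  proof -
    have "poly (gamma z) r \<noteq> 0" for r
      using gamma_root_discriminant[of z r] that is_nth_powerI by metis
    thus ?thesis by (simp add: linear_factors_eq)
  qed
  show "linear_factors (gamma z) = {[:-1, 1:]}" if "z = -4"
  proof -
    have "poly (gamma z) r = (r - 1) ^ 2" for r
      unfolding poly_gamma that by (simp add: power2_eq_square algebra_simps)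
    thus ?thesis by (auto simp: linear_factors_eq)
  qed
  show "let r_plus = (- (z + 2) + s) / 2; r_minus = (- (z + 2) - s) / 2 in
          r_plus \<noteq> r_minus \<and>
          linear_factors (gamma z) = {[:- r_plus, 1:], [:- r_minus, 1:]}"
    if ne: "z ^ 2 + 4 * z \<noteq> 0" and s: "s ^ 2 = z ^ 2 + 4 * z" for s
  proof -
    note two = two_nonzero_mod_ring[OF assms(1)]
    have four: "(2 * 2 :: 'p Fp) \<noteq> 0" using two by (simp only: mult_eq_0_iff) simp
    define r_plus r_minus where "r_plus = (- (z + 2) + s) / 2" "r_minus = (- (z + 2) - s) / 2"
    note defs = this
    have double: "2 * r_plus = - (z + 2) + s" "2 * r_minus = - (z + 2) - s"
      using two by (simp_all add: defs)
    have "s \<noteq> 0" using ne by (auto simp flip: s)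
    have "r_plus \<noteq> r_minus"
    proof
      assume "r_plus = r_minus"
      hence "- (z + 2) + s = - (z + 2) - s" using double by simp
      hence "2 * s = 0" by (simp add: eq_neg_iff_add_eq_0)
      thus False using two \<open>s \<noteq> 0\<close> by simp
    qed
    moreover have "poly (gamma z) r = 0 \<longleftrightarrow> r = r_plus \<or> r = r_minus" for r
    proof -
      \<comment> \<open>Multiplying by 4, which is nonzero for odd \<open>p\<close>, completes the
        square; the result is a difference of squares that splits into the two linear terms.\<close>
      have "poly (gamma z) r = 0 \<longleftrightarrow> (2 * 2) * poly (gamma z) r = 0"
        using four by (simp only: mult_eq_0_iff) simp
      also have "(2 * 2) * poly (gamma z) r = (2 * r + (z + 2)) ^ 2 - s ^ 2"
        unfolding poly_gamma s by (simp add: power2_eq_square algebra_simps)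
      also have "\<dots> = (2 * r - 2 * r_plus) * (2 * r - 2 * r_minus)"
        unfolding double by (simp add: power2_eq_square algebra_simps)
      also have "\<dots> = (2 * 2) * ((r - r_plus) * (r - r_minus))" by (simp add: algebra_simps)
      finally show ?thesis using four by (simp only: mult_eq_0_iff right_minus_eq) simp
    qed
    ultimately show ?thesis
      unfolding Let_def linear_factors_eq defs[symmetric] by auto
  qed
qed

end
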